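(* Let $F(n)=\sum_{\pi\in S_n}q^{(b-ca)(\pi)}$ for $n\ge0$ (so $F(0)=1$). For $n,k\ge1$ let $$a(n,k)=\sum_{n\ge t_1>\cdots>t_k\ge1}\ \prod_{j=1}^{k-1}\bigl(q^{t_j-t_{j+1}-1}-1\bigr),\qquad b(n,k)=\sum_{n\ge t_1>\cdots>t_k\ge1}q^{-t_1}\prod_{j=1}^{k-1}\bigl(q^{t_j-t_{j+1}-1}-1\bigr).$$ Then for all $n\ge1$, $$F(n)=\sum_{k=1}^n a(n,k)F(n-k),$$ and for all $n,k\ge2$, $$a(n,k)=a(n-1,k)+q^{n-1}b(n-1,k-1)-a(n-1,k-1),$$ $$b(n,k)=b(n-1,k)+q^{-n}\bigl(q^{n-1}b(n-1,k-1)-a(n-1,k-1)\bigr),$$ with $a(n,1)=n$ and $b(n,1)=\sum_{i=1}^nq^{-i}$ for $n\ge1$, and $a(n,k)=b(n,k)=0$ for $k\ge n$, $k\ge2$. The same recurrence for $F$ (with the same $a(n,k)$) holds when $(b-ca)$ is replaced by its reversal, its complement, or its reverse-complement.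
   Context: $S_n$ is the set of permutations $\pi=\pi_1\cdots\pi_n$ of $\{1,\dots,n\}$ in one-line notation. $(b-ca)(\pi)$ is the number of pairs $(i,j)$ with $1\le i<j<n$ and $\pi_{j+1}<\pi_i<\pi_j$. The sums are over integer tuples $(t_1,\dots,t_k)$; empty sums are $0$ and empty products are $1$; $q$ is an (invertible) indeterminate. For a statistic $\sigma$, the reversal, complement and reverse-complement are $\sigma^r(\pi)=\sigma(\pi^r)$, $\sigma^c(\pi)=\sigma(\pi^c)$ and $\sigma^{cr}(\pi)=\sigma((\pi^c)^r)$, where $\pi^r=\pi_n\cdots\pi_1$ and $\pi^c=(n+1-\pi_1)\cdots(n+1-\pi_n)$. *)

theory Defs
  imports
    "HOL-Computational_Algebra.Formal_Laurent_Series"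
    "HOL-Combinatorics.Multiset_Permutations"
begin

text \<open>
  A permutation of \<open>{1..n}\<close> is its one-line word, a list over \<open>nat\<close>. Words and tuples are
  indexed from 1 in the mathematics and from 0 in lists, hence \<open>entry\<close>.
\<close>

definition entry :: "'a list \<Rightarrow> nat \<Rightarrow> 'a" where
  "entry w i = w ! (i - 1)"

definition Sym :: "nat \<Rightarrow> nat list set" where
  "Sym n = permutations_of_set {1..n}"

definition stat_b_ca :: "nat list \<Rightarrow> nat" where
  "stat_b_ca p = card {(i, j). 1 \<le> i \<and> i < j \<and> j < length p \<and>
     entry p (j + 1) < entry p i \<and> entry p i < entry p j}"

text \<open>The subtraction does not truncate, since the entries of \<open>p\<close> are at most \<open>length p\<close>.\<close>

definition perm_compl :: "nat list \<Rightarrow> nat list" where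
  "perm_compl p = map (\<lambda>x. length p + 1 - x) p"

definition stat_rev :: "(nat list \<Rightarrow> nat) \<Rightarrow> nat list \<Rightarrow> nat" where
  "stat_rev \<sigma> p = \<sigma> (rev p)"

definition stat_compl :: "(nat list \<Rightarrow> nat) \<Rightarrow> nat list \<Rightarrow> nat" where
  "stat_compl \<sigma> p = \<sigma> (perm_compl p)"

definition stat_rev_compl :: "(nat list \<Rightarrow> nat) \<Rightarrow> nat list \<Rightarrow> nat" where
  "stat_rev_compl \<sigma> p = \<sigma> (rev (perm_compl p))"

text \<open>
  The invertible indeterminate \<open>q\<close> is the indeterminate of the formal Laurent series over the
  integers, a ring that contains the Laurent polynomials; \<open>qpow i\<close> is its \<open>i\<close>-th power for
  any integer \<open>i\<close>.
\<close>

abbreviation qpow :: "int \<Rightarrow> int fls" where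
  "qpow i \<equiv> fls_X_intpow i"

definition gen_fun :: "(nat list \<Rightarrow> nat) \<Rightarrow> nat \<Rightarrow> int fls" where
  "gen_fun \<sigma> n = (\<Sum>p\<in>Sym n. qpow (int (\<sigma> p)))"

text \<open>The integer tuples \<open>(t\<^sub>1, \<dots>, t\<^sub>k)\<close> with \<open>n \<ge> t\<^sub>1 > \<dots> > t\<^sub>k \<ge> 1\<close>.\<close>

definition dec_tuples :: "nat \<Rightarrow> nat \<Rightarrow> int list set" where
  "dec_tuples n k = {t. length t = k \<and> sorted_wrt (>) t \<and> set t \<subseteq> {1..int n}}"

definition tuple_weight :: "nat \<Rightarrow> int list \<Rightarrow> int fls" where
  "tuple_weight k t = (\<Prod>j\<in>{1..<k}. (qpow (entry t j - entry t (j + 1) - 1) - 1))"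

definition coeff_a :: "nat \<Rightarrow> nat \<Rightarrow> int fls" where
  "coeff_a n k = (\<Sum>t\<in>dec_tuples n k. tuple_weight k t)"

definition coeff_b :: "nat \<Rightarrow> nat \<Rightarrow> int fls" where
  "coeff_b n k = (\<Sum>t\<in>dec_tuples n k. qpow (- entry t 1) * tuple_weight k t)"

end

theory Submission
  imports Defs
begin

text \<open>
  Append a last letter \<open>y\<close> to a permutation of \<open>{1..m}\<close> with last letter \<open>x\<close>, raising the letters
  \<open>\<ge> y\<close> by 1. Every other letter occurs earlier, so this creates exactly \<open>max 0 (x - y)\<close> new
  occurrences of the pattern. Hence \<open>G(m + 1, y) = F(m) + (\<Sum>x=y..m. (q^(x - y) - 1) G(m, x))\<close>,
  where \<open>G(m, y)\<close> counts the permutations of \<open>{1..m}\<close> ending in \<open>y\<close>. Iterating from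
  \<open>F(n) = (\<Sum>y=1..n. G(n, y))\<close> gives weakly increasing chains of last letters; adding \<open>n - m\<close> to
  the last letter of a permutation of \<open>{1..m}\<close> makes them strictly increasing, and read backwards
  they are the tuples of \<open>a(n, k)\<close>. The recurrences for \<open>a\<close> and \<open>b\<close> split the tuples according to
  whether \<open>t\<^sub>1 = n\<close>.
\<close>

section \<open>Powers of \<open>q\<close> and permutation words\<close>

lemma qpow_add: "qpow (i + j) = qpow i * qpow j"
  by (simp add: fls_X_intpow_times_fls_X_intpow)

lemma Sym_iff: "p \<in> Sym n \<longleftrightarrow> distinct p \<and> set p = {1..n}"
  by (auto simp: Sym_def permutations_of_set_def)

lemma length_Sym: "p \<in> Sym n \<Longrightarrow> length p = n"
  by (metis Sym_iff card_atLeastAtMost diff_Suc_1 distinct_card)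

lemma finite_Sym: "finite (Sym n)"
  by (simp add: Sym_def)

lemma Sym_0: "Sym 0 = {[]}"
  by (auto simp: Sym_def)

section \<open>Strictly decreasing tuples and their weights\<close>

lemma finite_dec_tuples: "finite (dec_tuples n k)"
proof (rule finite_subset)
  show "dec_tuples n k \<subseteq> {t. set t \<subseteq> {1..int n} \<and> length t = k}"
    by (auto simp: dec_tuples_def)
  show "finite {t. set t \<subseteq> {1..int n} \<and> length t = k}"
    by (rule finite_lists_length_eq) simp
qed

text \<open>Comparing \<open>v\<close> with \<open>hd t\<close> suffices, since the other entries of
  \<open>t\<close> lie below its head; \<open>k >= 1\<close> makes that head exist.\<close>

lemma Cons_in_dec_tuples_iff:
  assumes "k \<ge> 1"
  shows "v # t \<in> dec_tuples n (Suc k) \<longleftrightarrow> t \<in> dec_tuples n k \<and> hd t < v \<and> v \<le> int n"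
    (is "?L \<longleftrightarrow> ?R")
proof
  assume ?L
  then show ?R using assms by (cases t) (auto simp: dec_tuples_def)
next
  assume ?R
  then show ?L using assms by (cases t) (auto simp: dec_tuples_def)
qed

text \<open>Read from the right, the entries start at 1 or more and grow by at least 1 each
  time.\<close>

lemma length_le_hd_dec_tuples:
  "t \<in> dec_tuples n (Suc k) \<Longrightarrow> int (Suc k) \<le> hd t"
proof (induction k arbitrary: t)
  case 0
  then show ?case by (cases t) (auto simp: dec_tuples_def)
next
  case (Suc k)
  obtain v s where t: "t = v # s"
    using Suc.prems by (cases t) (auto simp: dec_tuples_def)
  have "s \<in> dec_tuples n (Suc k)" "hd s < v"
    using Suc.prems Cons_in_dec_tuples_iff[of "Suc k" v s n] by (simp_all add: t)
  with Suc.IH[of s] show ?case by (simp add: t)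
qed

lemma hd_dec_tuples_le: "t \<in> dec_tuples n (Suc k) \<Longrightarrow> hd t \<le> int n"
  by (cases t) (auto simp: dec_tuples_def)

lemma dec_tuples_empty:
  assumes "k > n" shows "dec_tuples n k = {}"
proof -
  obtain j where "k = Suc j" using assms by (cases k) auto
  then show ?thesis
    using assms length_le_hd_dec_tuples[of _ n j] hd_dec_tuples_le[of _ n j] by fastforce
qed

lemma dec_tuples_1: "dec_tuples n 1 = (\<lambda>v. [v]) ` {1..int n}"
  by (auto simp: dec_tuples_def length_Suc_conv)

lemma dec_tuples_Suc_Suc:
  assumes "k \<ge> 1"
  shows "dec_tuples (Suc n) (Suc k)
    = dec_tuples n (Suc k) \<union> (#) (int (Suc n)) ` dec_tuples n k"
proof (intro equalityI subsetI)
  fix t assume t: "t \<in> dec_tuples (Suc n) (Suc k)"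
  then obtain v s where vs: "t = v # s" by (cases t) (auto simp: dec_tuples_def)
  show "t \<in> dec_tuples n (Suc k) \<union> (#) (int (Suc n)) ` dec_tuples n k"
    using t by (cases "v = int (Suc n)") (fastforce simp: dec_tuples_def vs)+
next
  fix t assume "t \<in> dec_tuples n (Suc k) \<union> (#) (int (Suc n)) ` dec_tuples n k"
  then show "t \<in> dec_tuples (Suc n) (Suc k)"
    by (fastforce simp: dec_tuples_def)
qed

lemma tuple_weight_Cons:
  assumes "length t = k" "k \<ge> 1"
  shows "tuple_weight (Suc k) (v # t) = (qpow (v - hd t - 1) - 1) * tuple_weight k t"
proof -
  have "t \<noteq> []" using assms by auto
  then have hd: "entry (v # t) 1 = v" "entry (v # t) 2 = hd t"
    by (simp_all add: entry_def hd_conv_nth)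
  have shift: "entry (v # t) (Suc j) = entry t j" if "1 \<le> j" for j
    using that by (simp add: entry_def nth_Cons')
  let ?f = "\<lambda>j. qpow (entry (v # t) j - entry (v # t) (j + 1) - 1) - 1"
  \<comment> \<open>Only the factor \<open>j = 1\<close> involves \<open>v\<close>; the others are
    those of \<open>t\<close> with indices one higher.\<close>
  have "tuple_weight (Suc k) (v # t) = ?f 1 * (\<Prod>j\<in>{Suc 1..<Suc k}. ?f j)"
    unfolding tuple_weight_def using assms(2) by (intro prod.atLeast_Suc_lessThan) simp
  also have "(\<Prod>j\<in>{Suc 1..<Suc k}. ?f j) = tuple_weight k t"
    unfolding tuple_weight_def prod.shift_bounds_Suc_ivl
    by (rule prod.cong) (simp_all add: shift)
  finally show ?thesis by (simp only: hd one_add_one)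
qed

lemma tuple_weight_1: "tuple_weight 1 t = 1"
  by (simp add: tuple_weight_def)

text \<open>Cutting off the head is a bijection onto pairs of tail and head. This form serves the
  iteration over last letters; the split on whether the head is the maximum, below, serves the
  recurrences for a and b.\<close>

lemma sum_dec_tuples_Suc:
  assumes "k \<ge> 1"
  shows "(\<Sum>t\<in>dec_tuples n (Suc k). f t)
    = (\<Sum>t\<in>dec_tuples n k. \<Sum>v\<in>{hd t<..int n}. f (v # t))"
proof -
  have "(\<Sum>t\<in>dec_tuples n k. \<Sum>v\<in>{hd t<..int n}. f (v # t))
      = (\<Sum>(t, v)\<in>(SIGMA t:dec_tuples n k. {hd t<..int n}). f (v # t))"
    by (rule sum.Sigma) (auto simp: finite_dec_tuples)
  also have "\<dots> = (\<Sum>t\<in>dec_tuples n (Suc k). f t)"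
  proof (rule sum.reindex_bij_witness[where i = "\<lambda>t. (tl t, hd t)" and j = "\<lambda>(t, v). v # t"])
    fix t assume t: "t \<in> dec_tuples n (Suc k)"
    then obtain v s where vs: "t = v # s" by (cases t) (auto simp: dec_tuples_def)
    show "(tl t, hd t) \<in> (SIGMA t:dec_tuples n k. {hd t<..int n})"
      using t by (simp add: vs Cons_in_dec_tuples_iff[OF assms])
    show "(case (tl t, hd t) of (t, v) \<Rightarrow> v # t) = t" by (simp add: vs)
  qed (auto simp: Cons_in_dec_tuples_iff[OF assms])
  finally show ?thesis by simp
qed

lemma sum_dec_tuples_Suc_Suc:
  assumes "k \<ge> 1"
  shows "(\<Sum>t\<in>dec_tuples (Suc n) (Suc k). f t)
    = (\<Sum>t\<in>dec_tuples n (Suc k). f t) + (\<Sum>t\<in>dec_tuples n k. f (int (Suc n) # t))"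
proof -
  have "dec_tuples n (Suc k) \<inter> (#) (int (Suc n)) ` dec_tuples n k = {}"
    by (auto simp: dec_tuples_def)
  then show ?thesis
    by (simp add: dec_tuples_Suc_Suc[OF assms] sum.union_disjoint finite_dec_tuples sum.reindex)
qed

section \<open>Recurrences and boundary values of a and b\<close>

lemma sum_tuple_weight_Cons:
  assumes "k \<ge> 1"
  shows "(\<Sum>t\<in>dec_tuples n k. tuple_weight (Suc k) (int (Suc n) # t))
    = qpow (int n) * coeff_b n k - coeff_a n k"
proof -
  have "tuple_weight (Suc k) (int (Suc n) # t)
      = qpow (int n) * (qpow (- entry t 1) * tuple_weight k t) - tuple_weight k t"
    if "t \<in> dec_tuples n k" for t
  proof -
    have len: "length t = k" using that by (simp add: dec_tuples_def)
    then have "hd t = entry t 1" using assms by (cases t) (auto simp: entry_def)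
    \<comment> \<open>The new first factor is \<open>q^n * q^(-hd t) - 1\<close>: its first term
      brings in the weight of b, its second the weight of a. This is why b accompanies a.\<close>
    then have "int (Suc n) - hd t - 1 = int n + (- entry t 1)" by simp
    then have "tuple_weight (Suc k) (int (Suc n) # t)
        = (qpow (int n) * qpow (- entry t 1) - 1) * tuple_weight k t"
      by (simp only: tuple_weight_Cons[OF len assms] qpow_add)
    then show ?thesis
      by (simp only: left_diff_distrib mult.assoc mult_1_left)
  qed
  then show ?thesis
    by (simp add: coeff_a_def coeff_b_def sum_subtractf sum_distrib_left)
qed

lemma coeff_a_rec:
  assumes "k \<ge> 1"
  shows "coeff_a (Suc n) (Suc k)
    = coeff_a n (Suc k) + (qpow (int n) * coeff_b n k - coeff_a n k)"
  unfolding sum_tuple_weight_Cons[OF assms, symmetric]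
  by (simp only: coeff_a_def sum_dec_tuples_Suc_Suc[OF assms])

text \<open>The new tuples all have first entry \<open>Suc n\<close>, so the extra weight
  \<open>q^(-t_1)\<close> is a constant factor.\<close>

lemma coeff_b_rec:
  assumes "k \<ge> 1"
  shows "coeff_b (Suc n) (Suc k)
    = coeff_b n (Suc k) + qpow (- int (Suc n)) * (qpow (int n) * coeff_b n k - coeff_a n k)"
  unfolding sum_tuple_weight_Cons[OF assms, symmetric]
  by (simp add: coeff_b_def sum_dec_tuples_Suc_Suc[OF assms] sum_distrib_left entry_def
      del: of_nat_Suc)

lemma coeff_a_1: "coeff_a n 1 = of_nat n"
  unfolding coeff_a_def dec_tuples_1 tuple_weight_1 by (simp add: card_image inj_on_def)

lemma coeff_b_1: "coeff_b n 1 = (\<Sum>i=1..n. qpow (- int i))"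
proof -
  have "coeff_b n 1 = (\<Sum>v\<in>{1..int n}. qpow (- v))"
    unfolding coeff_b_def dec_tuples_1 tuple_weight_1
    by (simp add: sum.reindex inj_on_def entry_def)
  also have "\<dots> = (\<Sum>i=1..n. qpow (- int i))"
    by (rule sum.reindex_bij_witness[where i = int and j = nat]) auto
  finally show ?thesis .
qed

text \<open>The only tuple with \<open>k = n\<close> entries is \<open>(n, \<dots>, 1)\<close>, whose adjacent entries differ by 1.\<close>

lemma tuple_weight_eq_0:
  assumes "t \<in> dec_tuples n k" "k \<ge> 2" "k \<ge> n"
  shows "tuple_weight k t = 0"
proof -
  obtain j where k: "k = Suc (Suc j)" using assms(2) by (metis Suc_le_D numeral_2_eq_2 Suc_le_mono)
  obtain v s where t: "t = v # s" using assms(1) k by (cases t) (auto simp: dec_tuples_def)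
  have s: "s \<in> dec_tuples n (Suc j)" "hd s < v" "v \<le> int n"
    using assms(1) by (simp_all add: k t Cons_in_dec_tuples_iff)
  have "int (Suc j) \<le> hd s" by (rule length_le_hd_dec_tuples[OF s(1)])
  \<comment> \<open>From \<open>k - 1 <= hd s < v <= n <= k\<close> the entries \<open>v\<close> and
    \<open>hd s\<close> are consecutive, so the leading factor is \<open>q^0 - 1\<close>.\<close>
  then have "v - hd s - 1 = 0" using s(2,3) assms(3) k by linarith
  moreover have "length s = Suc j" using s(1) by (simp add: dec_tuples_def)
  ultimately show ?thesis by (simp add: k t tuple_weight_Cons)
qed

lemma coeff_eq_0:
  assumes "k \<ge> 2" "k \<ge> n"
  shows "coeff_a n k = 0" "coeff_b n k = 0"
  using assms by (simp_all add: coeff_a_def coeff_b_def tuple_weight_eq_0)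

section \<open>Appending a last letter to a permutation\<close>

definition raise :: "nat \<Rightarrow> nat \<Rightarrow> nat" where
  "raise y x = (if x < y then x else Suc x)"

text \<open>Since \<open>raise y\<close> is the increasing bijection onto the numbers other than
  \<open>y\<close>, this undoes deleting the last letter and standardising the rest.\<close>

definition extend :: "nat \<Rightarrow> nat list \<Rightarrow> nat list" where
  "extend y p = map (raise y) p @ [y]"

lemma raise_less_iff: "raise y a < raise y b \<longleftrightarrow> a < b"
  by (auto simp: raise_def)

lemma inj_raise: "inj (raise y)"
  by (auto simp: inj_def raise_def split: if_splits)

lemma raise_image:
  assumes "1 \<le> y" "y \<le> Suc m"
  shows "raise y ` {1..m} = {1..Suc m} - {y}"
proof (intro equalityI subsetI)
  fix x assume x: "x \<in> {1..Suc m} - {y}"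
  show "x \<in> raise y ` {1..m}"
  proof (cases "x < y")
    case True
    then have "x = raise y x" "x \<in> {1..m}" using x assms by (auto simp: raise_def)
    then show ?thesis by blast
  next
    case False
    then have "x = raise y (x - 1)" "x - 1 \<in> {1..m}" using x assms by (auto simp: raise_def)
    then show ?thesis by blast
  qed
qed (use assms in \<open>auto simp: raise_def split: if_splits\<close>)

lemma bij_betw_extend:
  assumes "1 \<le> y" "y \<le> Suc m"
  shows "bij_betw (extend y) (Sym m) {p \<in> Sym (Suc m). last p = y}"
  unfolding bij_betw_def
proof
  show "inj_on (extend y) (Sym m)"
    by (rule inj_onI) (simp add: extend_def inj_map_eq_map[OF inj_raise])
  show "extend y ` Sym m = {p \<in> Sym (Suc m). last p = y}"
  proof (intro equalityI subsetI)
    fix p assume "p \<in> extend y ` Sym m"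
    then obtain p' where p': "p' \<in> Sym m" "p = extend y p'" by blast
    have "raise y ` set p' = {1..Suc m} - {y}"
      using raise_image[OF assms] p'(1) by (simp add: Sym_iff)
    then show "p \<in> {p \<in> Sym (Suc m). last p = y}"
      using p' assms inj_on_subset[OF inj_raise]
      by (auto simp: Sym_iff extend_def distinct_map)
  next
    fix p assume p: "p \<in> {p \<in> Sym (Suc m). last p = y}"
    then have "p \<noteq> []" by (auto simp: Sym_iff)
    then have "butlast p @ [y] = p" using p append_butlast_last_id[of p] by simp
    then obtain b where b: "p = b @ [y]" by metis
    then have dist: "distinct b" "y \<notin> set b" and "insert y (set b) = {1..Suc m}"
      using p by (auto simp: Sym_iff)
    \<comment> \<open>All letters before the final \<open>y\<close> differ from \<open>y\<close>, so
      \<open>raise y\<close> can be undone letter by letter.\<close>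
    then have set: "set b = raise y ` {1..m}"
      unfolding raise_image[OF assms] by blast
    then have "b \<in> lists (range (raise y))" by auto
    then obtain p' where p': "b = map (raise y) p'" unfolding lists_image by auto
    have "set p' = {1..m}"
      using set unfolding p' list.set_map inj_image_eq_iff[OF inj_raise] .
    then have "p' \<in> Sym m" using dist(1) p' by (simp add: Sym_iff distinct_map)
    moreover have "p = extend y p'" by (simp add: b p' extend_def)
    ultimately show "p \<in> extend y ` Sym m" by blast
  qed
qed

text \<open>Every letter strictly between the last two letters occurs before them.\<close>

lemma stat_b_ca_extend:
  assumes p: "p \<in> Sym m" and m: "m \<ge> 1" and y: "1 \<le> y" "y \<le> Suc m"
  shows "stat_b_ca (extend y p) = stat_b_ca p + (last p - y)"
proof -
  have len: "length p = m" using p by (rule length_Sym)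
  then have ne: "p \<noteq> []" using m by auto
  have last: "last p = p ! (m - 1)" using ne len by (simp add: last_conv_nth)
  let ?B = "\<lambda>w. {(i, j). 1 \<le> i \<and> i < j \<and> j < length w \<and>
     entry w (j + 1) < entry w i \<and> entry w i < entry w j}"
  \<comment> \<open>The positions \<open>i\<close> for which \<open>(i, m)\<close> becomes an
    occurrence; the bound \<open>y <=\<close> is weak because a letter equal to \<open>y\<close>
    gets raised above it.\<close>
  let ?I = "{i. 1 \<le> i \<and> i < m \<and> y \<le> entry p i \<and> entry p i < last p}"
  have ent: "entry (extend y p) i = raise y (entry p i)" if "1 \<le> i" "i \<le> m" for i
  proof -
    have "i - 1 < m" using that by simp
    then show ?thesis by (simp add: entry_def extend_def nth_append len)
  qed
  have ent': "entry (extend y p) (Suc m) = y"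
    by (simp add: entry_def extend_def nth_append len)
  have gt: "y < raise y x \<longleftrightarrow> y \<le> x" for x by (auto simp: raise_def)
  have lst: "entry p m = last p" by (simp add: entry_def last)
  \<comment> \<open>Pairs with \<open>j < m\<close> are unaffected, as \<open>raise y\<close>
    preserves order; only \<open>j = m\<close> uses the appended letter.\<close>
  have B: "?B (extend y p) = ?B p \<union> (\<lambda>i. (i, m)) ` ?I"
  proof (intro equalityI subsetI)
    fix z assume z: "z \<in> ?B (extend y p)"
    obtain i j where ij: "z = (i, j)" by (cases z)
    have b: "1 \<le> i" "i < j" "j < Suc m"
      using z by (auto simp: ij extend_def len)
    show "z \<in> ?B p \<union> (\<lambda>i. (i, m)) ` ?I"
      using z b by (cases "j = m") (auto simp: ij ent ent' gt lst raise_less_iff len)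
  next
    fix z assume "z \<in> ?B p \<union> (\<lambda>i. (i, m)) ` ?I"
    then show "z \<in> ?B (extend y p)"
      by (auto simp: ent ent' gt lst raise_less_iff len) (auto simp: extend_def len)
  qed
  have fin: "finite (?B p)"
    by (rule finite_subset[of _ "{..length p} \<times> {..length p}"]) auto
  have disj: "?B p \<inter> (\<lambda>i. (i, m)) ` ?I = {}" by (auto simp: len)
  have "entry p ` ?I = {y..<last p}"
  proof (intro equalityI subsetI)
    fix x assume x: "x \<in> {y..<last p}"
    have "last p \<in> set p" using ne by simp
    then have "x \<in> set p" using x y p by (auto simp: Sym_iff)
    then obtain i where i: "i < m" "p ! i = x" by (auto simp: in_set_conv_nth len)
    have "Suc i \<noteq> m" using i x last by auto
    then have "Suc i \<in> ?I" using i x by (simp add: entry_def)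
    moreover have "x = entry p (Suc i)" using i by (simp add: entry_def)
    ultimately show "x \<in> entry p ` ?I" by blast
  qed auto
  moreover have "inj_on (entry p) ?I"
  proof (rule inj_onI)
    fix i j assume "i \<in> ?I" "j \<in> ?I" "entry p i = entry p j"
    moreover have "distinct p" using p by (simp add: Sym_iff)
    ultimately have "i - 1 = j - 1" "i \<ge> 1" "j \<ge> 1"
      by (auto simp: entry_def nth_eq_iff_index_eq len)
    then show "i = j" by linarith
  qed
  \<comment> \<open>For \<open>last p <= y\<close> the interval is empty and the truncated
    difference is 0.\<close>
  ultimately have "card ?I = last p - y" using card_image by fastforce
  moreover have "card ((\<lambda>i. (i, m)) ` ?I) = card ?I" by (rule card_image) (simp add: inj_on_def)
  moreover have "stat_b_ca (extend y p) = card (?B p \<union> (\<lambda>i. (i, m)) ` ?I)"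
    unfolding stat_b_ca_def B ..
  moreover have "\<dots> = card (?B p) + card ((\<lambda>i. (i, m)) ` ?I)"
    by (rule card_Un_disjoint[OF fin _ disj]) simp
  ultimately show ?thesis by (simp add: stat_b_ca_def)
qed

section \<open>Generating functions by last letter\<close>

definition gen_last :: "nat \<Rightarrow> nat \<Rightarrow> int fls" where
  "gen_last m y = (\<Sum>p\<in>{p \<in> Sym m. last p = y}. qpow (int (stat_b_ca p)))"

lemma stat_b_ca_singleton: "stat_b_ca [y] = 0"
proof -
  have "{(i, j). 1 \<le> i \<and> i < j \<and> j < length [y] \<and>
     entry [y] (j + 1) < entry [y] i \<and> entry [y] i < entry [y] j} = {}"
    by auto
  then show ?thesis by (simp only: stat_b_ca_def card.empty)
qed

lemma stat_b_ca_Nil: "stat_b_ca [] = 0"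
  by (simp add: stat_b_ca_def)

lemma sum_Sym_last:
  assumes "m \<ge> 1"
  shows "(\<Sum>p\<in>Sym m. f p) = (\<Sum>x=1..m. \<Sum>p\<in>{p \<in> Sym m. last p = x}. f p)"
proof (rule sum.group[symmetric])
  show "last ` Sym m \<subseteq> {1..m}"
  proof
    fix x assume "x \<in> last ` Sym m"
    then obtain p where "p \<in> Sym m" "x = last p" by blast
    moreover from this have "p \<noteq> []" using assms by (auto simp: Sym_iff)
    ultimately show "x \<in> {1..m}" using last_in_set by (auto simp: Sym_iff)
  qed
qed (simp_all add: finite_Sym)

lemma gen_fun_eq_sum_gen_last:
  "m \<ge> 1 \<Longrightarrow> gen_fun stat_b_ca m = (\<Sum>y=1..m. gen_last m y)"
  unfolding gen_fun_def gen_last_def by (rule sum_Sym_last)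

text \<open>The identity \<open>q^(s + d) = q^s + (q^d - 1) * q^s\<close> separates a term that
  ignores the last letter and sums to F(m) from a correction that depends on it.\<close>

lemma gen_last_Suc:
  assumes "1 \<le> y" "y \<le> Suc m"
  shows "gen_last (Suc m) y
    = gen_fun stat_b_ca m + (\<Sum>x\<in>{y..m}. (qpow (int (x - y)) - 1) * gen_last m x)"
proof -
  have reindex: "gen_last (Suc m) y = (\<Sum>p\<in>Sym m. qpow (int (stat_b_ca (extend y p))))"
    unfolding gen_last_def
    by (rule sum.reindex_bij_betw[OF bij_betw_extend[OF assms], symmetric])
  show ?thesis
  proof (cases "m = 0")
    case True
    then show ?thesis
      using reindex assms
      by (simp add: Sym_0 extend_def stat_b_ca_singleton stat_b_ca_Nil gen_fun_def)
  next
    case False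
    then have m: "m \<ge> 1" by simp
    let ?w = "\<lambda>x. qpow (int (x - y)) - 1"
    have "gen_last (Suc m) y
        = (\<Sum>p\<in>Sym m. qpow (int (stat_b_ca p)) + ?w (last p) * qpow (int (stat_b_ca p)))"
      unfolding reindex
    proof (rule sum.cong[OF refl])
      fix p assume "p \<in> Sym m"
      then have "stat_b_ca (extend y p) = stat_b_ca p + (last p - y)"
        using m assms by (rule stat_b_ca_extend)
      then show "qpow (int (stat_b_ca (extend y p)))
          = qpow (int (stat_b_ca p)) + ?w (last p) * qpow (int (stat_b_ca p))"
        by (simp only: of_nat_add qpow_add) (simp add: algebra_simps)
    qed
    also have "\<dots> = gen_fun stat_b_ca m
        + (\<Sum>x=1..m. \<Sum>p\<in>{p \<in> Sym m. last p = x}. ?w (last p) * qpow (int (stat_b_ca p)))"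
      unfolding sum.distrib gen_fun_def sum_Sym_last[OF m, symmetric] ..
    also have "(\<Sum>x=1..m. \<Sum>p\<in>{p \<in> Sym m. last p = x}. ?w (last p) * qpow (int (stat_b_ca p)))
        = (\<Sum>x=1..m. ?w x * gen_last m x)"
      unfolding gen_last_def sum_distrib_left by (intro sum.cong refl) simp
    \<comment> \<open>For \<open>x < y\<close> the truncated \<open>x - y\<close> is 0, so
      \<open>?w x\<close> vanishes.\<close>
    also have "\<dots> = (\<Sum>x\<in>{y..m}. ?w x * gen_last m x)"
      using assms by (intro sum.mono_neutral_right) auto
    finally show ?thesis .
  qed
qed

section \<open>Iteration along chains of last letters\<close>

lemma gen_last_shifted:
  assumes "int k < u" "u \<le> int n" "k < n"
  shows "gen_last (n - k) (nat u - k) = gen_fun stat_b_ca (n - Suc k)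
    + (\<Sum>v\<in>{u<..int n}. (qpow (v - u - 1) - 1) * gen_last (n - Suc k) (nat v - Suc k))"
proof -
  have n: "n - k = Suc (n - Suc k)" using assms by simp
  have "(\<Sum>x\<in>{nat u - k..n - Suc k}.
        (qpow (int (x - (nat u - k))) - 1) * gen_last (n - Suc k) x)
      = (\<Sum>v\<in>{u<..int n}. (qpow (v - u - 1) - 1) * gen_last (n - Suc k) (nat v - Suc k))"
  \<comment> \<open>The letter \<open>y = u - k\<close> is encoded by \<open>u\<close>, the next
    letter \<open>x\<close> by \<open>v = x + k + 1\<close>. The shift grows by 1, so
    \<open>x >= y\<close> becomes \<open>v > u\<close> and \<open>x - y\<close> becomes
    \<open>v - u - 1\<close>.\<close>
  proof (rule sum.reindex_bij_witness
      [where i = "\<lambda>v. nat v - Suc k" and j = "\<lambda>x. int (x + Suc k)"])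
    fix x assume x: "x \<in> {nat u - k..n - Suc k}"
    have "int (x - (nat u - k)) = int (x + Suc k) - u - 1" "nat (int (x + Suc k)) - Suc k = x"
      using x assms by auto
    then show "(qpow (int (x + Suc k) - u - 1) - 1)
          * gen_last (n - Suc k) (nat (int (x + Suc k)) - Suc k)
        = (qpow (int (x - (nat u - k))) - 1) * gen_last (n - Suc k) x" by (simp only:)
  qed (use assms in auto)
  moreover have "1 \<le> nat u - k" "nat u - k \<le> Suc (n - Suc k)" using assms by auto
  ultimately show ?thesis
    by (simp only: n gen_last_Suc)
qed

text \<open>Iterating the recurrence for \<open>gen_last\<close> prepends one entry to the tuple at each step.\<close>

lemma gen_fun_iterate:
  assumes "k \<le> n" "n \<ge> 1"
  shows "gen_fun stat_b_ca n = (\<Sum>i=1..k. coeff_a n i * gen_fun stat_b_ca (n - i))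
    + (\<Sum>t\<in>dec_tuples n (Suc k). tuple_weight (Suc k) t * gen_last (n - k) (nat (hd t) - k))"
  using assms(1)
proof (induction k)
  case 0
  \<comment> \<open>Before any step the tuples have one entry, the unshifted last letter, and weight
    1.\<close>
  have "gen_fun stat_b_ca n = (\<Sum>v\<in>{1..int n}. gen_last n (nat v))"
    unfolding gen_fun_eq_sum_gen_last[OF assms(2)]
    by (rule sum.reindex_bij_witness[where i = nat and j = int]) auto
  also have "\<dots> = (\<Sum>t\<in>dec_tuples n 1. tuple_weight 1 t * gen_last n (nat (hd t)))"
    unfolding dec_tuples_1 tuple_weight_1 by (simp add: sum.reindex inj_on_def)
  finally show ?case by simp
next
  case (Suc k)
  let ?F = "gen_fun stat_b_ca (n - Suc k)"
  let ?g = "\<lambda>v. gen_last (n - Suc k) (nat v - Suc k)"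
  have "tuple_weight (Suc k) t * gen_last (n - k) (nat (hd t) - k)
      = tuple_weight (Suc k) t * ?F
        + (\<Sum>v\<in>{hd t<..int n}. tuple_weight (Suc (Suc k)) (v # t) * ?g (hd (v # t)))"
    if t: "t \<in> dec_tuples n (Suc k)" for t
  proof -
    have "int k < hd t" "hd t \<le> int n" "k < n"
      using length_le_hd_dec_tuples[OF t] hd_dec_tuples_le[OF t] Suc.prems by auto
    then have "gen_last (n - k) (nat (hd t) - k)
        = ?F + (\<Sum>v\<in>{hd t<..int n}. (qpow (v - hd t - 1) - 1) * ?g v)"
      by (rule gen_last_shifted)
    moreover have "tuple_weight (Suc (Suc k)) (v # t)
        = tuple_weight (Suc k) t * (qpow (v - hd t - 1) - 1)" for v
    proof -
      have "length t = Suc k" using t by (simp add: dec_tuples_def)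
      then show ?thesis by (subst tuple_weight_Cons) (simp_all add: mult.commute)
    qed
    ultimately show ?thesis
      by (simp only: distrib_left sum_distrib_left mult.assoc list.sel)
  qed
  then have "(\<Sum>t\<in>dec_tuples n (Suc k).
        tuple_weight (Suc k) t * gen_last (n - k) (nat (hd t) - k))
      = (\<Sum>t\<in>dec_tuples n (Suc k). tuple_weight (Suc k) t * ?F
        + (\<Sum>v\<in>{hd t<..int n}. tuple_weight (Suc (Suc k)) (v # t) * ?g (hd (v # t))))"
    by (rule sum.cong[OF refl])
  \<comment> \<open>The terms with \<open>?F\<close> give the next summand of the recurrence; the
    double sum is the new remainder, over tuples one entry longer.\<close>
  also have "\<dots> = coeff_a n (Suc k) * ?F
        + (\<Sum>t\<in>dec_tuples n (Suc (Suc k)). tuple_weight (Suc (Suc k)) t * ?g (hd t))"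
    by (subst sum_dec_tuples_Suc[of "Suc k"])
      (simp_all only: sum.distrib coeff_a_def sum_distrib_right le_add1 plus_1_eq_Suc)
  finally have step: "(\<Sum>t\<in>dec_tuples n (Suc k).
        tuple_weight (Suc k) t * gen_last (n - k) (nat (hd t) - k))
      = coeff_a n (Suc k) * ?F
        + (\<Sum>t\<in>dec_tuples n (Suc (Suc k)). tuple_weight (Suc (Suc k)) t * ?g (hd t))" .
  have "(\<Sum>i=1..Suc k. coeff_a n i * gen_fun stat_b_ca (n - i))
      = (\<Sum>i=1..k. coeff_a n i * gen_fun stat_b_ca (n - i)) + coeff_a n (Suc k) * ?F"
    by simp
  then show ?case
    unfolding Suc.IH[OF Suc_leD[OF Suc.prems]] step by (simp only: add.assoc)
qed

text \<open>After \<open>n\<close> steps the remainder runs over tuples of \<open>n + 1\<close>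
  distinct entries from \<open>{1..n}\<close>, of which there are none.\<close>

lemma gen_fun_rec:
  assumes "n \<ge> 1"
  shows "gen_fun stat_b_ca n = (\<Sum>k=1..n. coeff_a n k * gen_fun stat_b_ca (n - k))"
  using gen_fun_iterate[of n n] assms by (simp add: dec_tuples_empty)

section \<open>Invariance under reversal and complement\<close>

lemma gen_fun_involution:
  assumes "\<And>p. p \<in> Sym n \<Longrightarrow> f p \<in> Sym n" "\<And>p. p \<in> Sym n \<Longrightarrow> f (f p) = p"
  shows "gen_fun (\<lambda>p. \<sigma> (f p)) n = gen_fun \<sigma> n"
  unfolding gen_fun_def
  by (rule sum.reindex_bij_witness[where i = f and j = f]) (simp_all add: assms)

lemma rev_Sym: "p \<in> Sym n \<Longrightarrow> rev p \<in> Sym n"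
  by (simp add: Sym_iff)

lemma perm_compl_Sym:
  assumes "p \<in> Sym n" shows "perm_compl p \<in> Sym n"
proof -
  have "(\<lambda>x. n + 1 - x) ` {1..n} = {1..n}"
  proof (intro equalityI subsetI)
    fix x assume "x \<in> {1..n}"
    then show "x \<in> (\<lambda>x. n + 1 - x) ` {1..n}"
      by (intro image_eqI[of _ _ "n + 1 - x"]) auto
  qed auto
  moreover have "inj_on (\<lambda>x. n + 1 - x) {1..n}" by (auto simp: inj_on_def)
  ultimately show ?thesis
    using assms by (simp add: perm_compl_def length_Sym[OF assms] Sym_iff distinct_map)
qed

lemma perm_compl_perm_compl:
  assumes "p \<in> Sym n" shows "perm_compl (perm_compl p) = p"
proof -
  \<comment> \<open>The truncated subtractions cancel because no letter exceeds
    \<open>length p\<close>.\<close>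
  have "map ((\<lambda>x. length p + 1 - x) \<circ> (\<lambda>x. length p + 1 - x)) p = p"
    by (rule map_idI) (use assms length_Sym[OF assms] in \<open>simp add: Sym_iff\<close>)
  then show ?thesis by (simp add: perm_compl_def)
qed

lemma perm_compl_rev: "perm_compl (rev p) = rev (perm_compl p)"
  by (simp add: perm_compl_def rev_map)

text \<open>Reversal and complement are commuting involutions of \<open>Sym n\<close>, so their
  composite is one too; each merely permutes the summands.\<close>

lemma gen_fun_symmetries:
  "gen_fun (stat_rev \<sigma>) n = gen_fun \<sigma> n"
  "gen_fun (stat_compl \<sigma>) n = gen_fun \<sigma> n"
  "gen_fun (stat_rev_compl \<sigma>) n = gen_fun \<sigma> n"
  using gen_fun_involution[of n rev \<sigma>] gen_fun_involution[of n perm_compl \<sigma>]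
    gen_fun_involution[of n "\<lambda>p. rev (perm_compl p)" \<sigma>]
  by (simp_all add: stat_rev_def[abs_def] stat_compl_def[abs_def] stat_rev_compl_def[abs_def]
      rev_Sym perm_compl_Sym perm_compl_perm_compl perm_compl_rev)

theorem mainTheorem7:
  shows "gen_fun stat_b_ca 0 = 1
    \<and> (\<forall>n\<ge>1. gen_fun stat_b_ca n = (\<Sum>k=1..n. coeff_a n k * gen_fun stat_b_ca (n - k)))
    \<and> (\<forall>n\<ge>2. \<forall>k\<ge>2.
         coeff_a n k = coeff_a (n - 1) k
           + qpow (int n - 1) * coeff_b (n - 1) (k - 1) - coeff_a (n - 1) (k - 1)
         \<and> coeff_b n k = coeff_b (n - 1) k
           + qpow (- int n) *
             (qpow (int n - 1) * coeff_b (n - 1) (k - 1) - coeff_a (n - 1) (k - 1)))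
    \<and> (\<forall>n\<ge>1. coeff_a n 1 = of_nat n \<and> coeff_b n 1 = (\<Sum>i=1..n. qpow (- int i)))
    \<and> (\<forall>n\<ge>1. \<forall>k\<ge>2. k \<ge> n \<longrightarrow> coeff_a n k = 0 \<and> coeff_b n k = 0)
    \<and> (\<forall>\<sigma>\<in>{stat_rev stat_b_ca, stat_compl stat_b_ca, stat_rev_compl stat_b_ca}. \<forall>n\<ge>1.
         gen_fun \<sigma> n = (\<Sum>k=1..n. coeff_a n k * gen_fun \<sigma> (n - k)))"
proof (intro conjI allI impI ballI)
  show "gen_fun stat_b_ca 0 = 1"
    by (simp add: gen_fun_def Sym_0 stat_b_ca_Nil)
next
  fix n :: nat assume "n \<ge> 1"
  then show "gen_fun stat_b_ca n = (\<Sum>k=1..n. coeff_a n k * gen_fun stat_b_ca (n - k))"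
    by (rule gen_fun_rec)
next
  fix n k :: nat assume nk: "2 \<le> n" "2 \<le> k"
  obtain m where m: "n = Suc m" using nk(1) by (cases n) auto
  obtain l where l: "k = Suc l" "l \<ge> 1" using nk(2) by (cases k) auto
  show "coeff_a n k = coeff_a (n - 1) k
      + qpow (int n - 1) * coeff_b (n - 1) (k - 1) - coeff_a (n - 1) (k - 1)"
    using coeff_a_rec[OF l(2), of m] by (simp add: m l(1) algebra_simps)
  show "coeff_b n k = coeff_b (n - 1) k + qpow (- int n) *
      (qpow (int n - 1) * coeff_b (n - 1) (k - 1) - coeff_a (n - 1) (k - 1))"
    using coeff_b_rec[OF l(2), of m] by (simp add: m l(1))
next
  fix n :: nat
  show "coeff_a n 1 = of_nat n" by (rule coeff_a_1)
  show "coeff_b n 1 = (\<Sum>i=1..n. qpow (- int i))" by (rule coeff_b_1)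
next
  fix n k :: nat assume "2 \<le> k" "n \<le> k"
  then show "coeff_a n k = 0" "coeff_b n k = 0" by (rule coeff_eq_0)+
next
  fix \<sigma> and n :: nat
  assume "\<sigma> \<in> {stat_rev stat_b_ca, stat_compl stat_b_ca, stat_rev_compl stat_b_ca}" "n \<ge> 1"
  then show "gen_fun \<sigma> n = (\<Sum>k=1..n. coeff_a n k * gen_fun \<sigma> (n - k))"
    \<comment> \<open>Each variant has the same generating function at every length, so both sides
      reduce to the recurrence for \<open>stat_b_ca\<close>.\<close>
    using gen_fun_rec[of n] by (auto simp: gen_fun_symmetries)
qed

end
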